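(* $$\mathcal{M}_{\frac{\varphi}{2}}=\{p^k: p\text{ an odd prime},\ k\ge 1 \text{ an integer}\}.$$
   Context: $\varphi$ is Euler's totient function. For positive integers $n,k$, $S_k(n):=\sum_{j=1}^n j^k$. $\mathcal{M}_{\frac{\varphi}{2}}$ is the set of integers $n\ge 3$ (so that $\varphi(n)/2$ is a positive integer) such that $n$ divides $S_{\varphi(n)/2}(n)$. *)

theory Defs
  imports "HOL-Number_Theory.Number_Theory"
begin

definition S :: "nat \<Rightarrow> nat \<Rightarrow> nat" where
  "S k n = (\<Sum>j = 1..n. j ^ k)"

text \<open>The bound \<open>n \<ge> 3\<close> makes \<open>totient n\<close> even and positive, so the natural number
  division by two is exact and the exponent is positive.\<close>

definition M_half_totient :: "nat set" where
  "M_half_totient = {n. n \<ge> 3 \<and> n dvd S (totient n div 2) n}"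

end

theory Submission
  imports Defs
begin

text \<open>
  Write \<open>m\<close> for \<open>\<phi>(n)/2\<close>. Only one prime power \<open>p\<^sup>a\<close> exactly dividing \<open>n\<close> has to be looked
  at, and the whole question is how \<open>j\<^sup>m\<close> behaves modulo \<open>p\<^sup>a\<close>. Since \<open>a \<le> m\<close> (the only
  exceptions are \<open>n = 4\<close> and \<open>n = 8\<close>), the multiples of \<open>p\<close> contribute nothing, and what
  remains is a power sum over residues prime to \<open>p\<close>.

  If \<open>n = p\<^sup>k\<close> with \<open>p\<close> odd, then \<open>m = p\<^bsup>k-1\<^esup>(p-1)/2\<close> is not a multiple of \<open>p-1\<close>. Multiplying
  the summation variable by a primitive root \<open>g\<close> modulo \<open>p\<close> permutes the units modulo \<open>p\<^sup>k\<close> and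
  multiplies the sum by \<open>g\<^sup>m\<close>; as \<open>g\<^sup>m - 1\<close> is prime to \<open>p\<close>, the sum vanishes modulo \<open>p\<^sup>k\<close>. This
  is \<open>prime_power_dvd_sum_totatives\<close>.

  If instead \<open>m\<close> is a multiple of the exponent of the unit group modulo \<open>p\<^sup>a\<close> (the Carmichael
  function), then every unit contributes \<open>1\<close>, the sum is congruent to \<open>n - n/p\<close>, and \<open>p\<^sup>a\<close> does
  not divide \<open>n/p\<close>. This is \<open>power_sum_not_dvd\<close>, and it covers all remaining \<open>n\<close> but two. When
  \<open>n = p\<^sup>a r\<close> with \<open>r \<ge> 3\<close> coprime to \<open>p\<close>, the factor \<open>\<phi>(r)\<close> is even and absorbs the division
  by two, so \<open>m\<close> is a multiple of \<open>\<phi>(p\<^sup>a)\<close>. When \<open>n = 2\<^sup>k\<close> with \<open>k \<ge> 4\<close>, the unit group is not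
  cyclic and its exponent is \<open>2\<^bsup>k-2\<^esup> = m\<close>. The values \<open>n = 4\<close> and \<open>n = 8\<close> are computed directly.
\<close>

lemma card_multiples_upto:
  fixes p n :: nat
  assumes "p > 0"
  shows "card {j \<in> {1..n}. p dvd j} = n div p"
proof -
  have "{j \<in> {1..n}. p dvd j} = (\<lambda>i. p * i) ` {1..n div p}"
    using assms by (fastforce simp: less_eq_div_iff_mult_less_eq mult.commute elim!: dvdE)
  moreover have "inj_on (\<lambda>i. p * i) {1..n div p}"
    using assms by (auto intro: inj_onI)
  ultimately show ?thesis
    by (simp add: card_image)
qed

lemma dvd_imp_power_dvd_power_le:
  fixes p j :: nat
  assumes "p dvd j" "a \<le> m"
  shows "p ^ a dvd j ^ m"
  using assms by (meson dvd_power_same dvd_trans le_imp_power_dvd)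

lemma le_totient_prime_power:
  fixes p :: nat
  assumes "prime p" "a \<ge> 1"
  shows "a \<le> totient (p ^ a)"
proof -
  have p: "p \<ge> 2" using assms prime_ge_2_nat by blast
  have "a - 1 < 2 ^ (a - 1)" by (rule less_exp)
  also have "\<dots> \<le> p ^ (a - 1)" using p by (simp add: power_mono)
  also have "\<dots> \<le> p ^ (a - 1) * (p - 1)" using p by simp
  also have "\<dots> = totient (p ^ a)" using assms by (simp add: totient_prime_power)
  finally show ?thesis by simp
qed

text \<open>
  The hypothesis on the Carmichael function makes \<open>j\<^sup>m\<close> congruent to \<open>1\<close> or \<open>0\<close> according to
  whether \<open>p\<close> fails to divide \<open>j\<close> or divides it. So adding \<open>1\<close> for each of the \<open>n/p\<close> multiples of
  \<open>p\<close> turns every summand into \<open>1\<close>, and the corrected sum is congruent to \<open>n\<close>, that is, to \<open>0\<close>.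
  The sum itself is therefore congruent to \<open>- n/p\<close>, which contains only \<open>a - 1\<close> factors \<open>p\<close>.
\<close>

lemma power_sum_not_dvd:
  fixes p n a r m :: nat
  assumes p: "prime p" and a: "1 \<le> a" "a \<le> m" and n: "n = p ^ a * r" and r: "coprime p r"
    and m: "Carmichael (p ^ a) dvd m"
  shows "\<not> p ^ a dvd S m n"
proof
  assume *: "p ^ a dvd S m n"
  have one: "[j ^ m + (if p dvd j then 1 else 0) = 1] (mod p ^ a)" for j
  proof (cases "p dvd j")
    case True
    then have "[j ^ m = 0] (mod p ^ a)"
      using dvd_imp_power_dvd_power_le a by (simp add: cong_0_iff)
    then show ?thesis
      using True cong_add[of "j ^ m" 0 "p ^ a" 1 1] by simp
  next
    case False
    then have "coprime j (p ^ a)"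
      using p by (metis coprime_commute coprime_power_right_iff prime_imp_coprime)
    then have "[j ^ m = 1] (mod p ^ a)"
      using Carmichael_divides[OF m] by (simp add: coprime_commute)
    then show ?thesis using False by simp
  qed
  have "{1..n} \<inter> {j. p dvd j} = {j \<in> {1..n}. p dvd j}" by blast
  then have "n div p = (\<Sum>j = 1..n. if p dvd j then 1 else 0)"
    using card_multiples_upto[of p n] p by (simp add: sum.If_cases prime_gt_0_nat)
  then have "S m n + n div p = (\<Sum>j = 1..n. j ^ m + (if p dvd j then 1 else 0))"
    by (simp only: S_def sum.distrib)
  also have "[\<dots> = (\<Sum>j = 1..n. 1)] (mod p ^ a)"
    using one by (rule cong_sum)
  also have "[(\<Sum>j = 1..n. 1) = 0] (mod p ^ a)"
    using n by (simp add: cong_0_iff)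
  finally have "p ^ a dvd S m n + n div p"
    by (simp add: cong_0_iff)
  with * have "p ^ a dvd n div p"
    by (simp add: dvd_add_right_iff)
  moreover have "p ^ a = p ^ (a - 1) * p" "n div p = p ^ (a - 1) * r"
    using a p n by (cases a; simp add: prime_gt_0_nat)+
  ultimately have "p dvd r" using p by (simp add: prime_gt_0_nat)
  with r p show False
    using coprime_absorb_left not_prime_unit by blast
qed

text \<open>
  The substitution \<open>j \<mapsto> g j\<close> shows that the sum \<open>A\<close> satisfies \<open>A = g\<^sup>m A\<close> modulo \<open>p\<^sup>a\<close>. It
  suffices to take \<open>g\<close> primitive modulo \<open>p\<close> rather than modulo \<open>p\<^sup>a\<close>: cancelling \<open>g\<^sup>m - 1\<close>
  only requires that \<open>p\<close> does not divide it.
\<close>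

lemma prime_power_dvd_sum_totatives:
  fixes p a m :: nat
  assumes p: "prime p" and a: "a \<ge> 1" and m: "\<not> (p - 1) dvd m"
  shows "p ^ a dvd (\<Sum>j \<in> totatives (p ^ a). j ^ m)"
proof -
  define n where "n = p ^ a"
  define A where "A = (\<Sum>j \<in> totatives n. j ^ m)"
  have n: "n > 1" using one_less_power[of p a] prime_gt_1_nat[OF p] a by (simp add: n_def)
  obtain g where g: "residue_primroot p g"
    using prime_primitive_root_exists[OF prime_gt_1_nat[OF p] p] by blast
  then have gp: "coprime g p" and ordg: "ord p g = p - 1"
    using p by (auto simp: residue_primroot_def totient_prime coprime_commute)
  have gn: "coprime g n" using gp by (simp add: n_def)
  have inj: "inj_on (\<lambda>j. g * j mod n) (totatives n)"
  proof (rule inj_onI)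
    fix i j assume ij: "i \<in> totatives n" "j \<in> totatives n" "g * i mod n = g * j mod n"
    then have "[i = j] (mod n)"
      using cong_mult_lcancel_nat[OF gn, of i j] by (simp add: cong_def)
    then show "i = j"
      using ij n totatives_less cong_less_modulus_unique_nat by metis
  qed
  have "g * j mod n \<in> totatives n" if "j \<in> totatives n" for j
  proof -
    have "coprime (g * j mod n) n"
      using that gn n by (simp add: in_totatives_iff)
    moreover from this have "g * j mod n \<noteq> 0"
      using n by (intro notI) simp
    ultimately show ?thesis
      using n by (simp add: in_totatives_iff)
  qed
  then have "(\<lambda>j. g * j mod n) ` totatives n \<subseteq> totatives n"
    by blast
  then have img: "(\<lambda>j. g * j mod n) ` totatives n = totatives n"
    using inj by (intro endo_inj_surj) auto
  have "A = (\<Sum>j \<in> totatives n. (g * j mod n) ^ m)"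
    unfolding A_def using inj sum.reindex[of _ "totatives n" "\<lambda>j. j ^ m"] by (subst img[symmetric]) simp
  also have "[\<dots> = (\<Sum>j \<in> totatives n. (g * j) ^ m)] (mod n)"
    by (intro cong_sum cong_pow) simp
  also have "(\<Sum>j \<in> totatives n. (g * j) ^ m) = g ^ m * A"
    by (simp add: A_def power_mult_distrib sum_distrib_left)
  finally have "[A * 1 = A * g ^ m] (mod n)" by (simp add: mult.commute)
  then have "int n dvd int A * (int g ^ m - 1)"
    by (simp add: cong_iff_dvd_diff algebra_simps dvd_diff_commute flip: cong_int_iff)
  moreover have "coprime (int n) (int g ^ m - 1)"
  proof -
    have "\<not> [g ^ m = 1] (mod p)"
      using m ordg ord_divides[of g m p] by simp
    then have "\<not> int p dvd int g ^ m - 1"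
      by (simp add: cong_iff_dvd_diff flip: cong_int_iff)
    then show ?thesis
      using p by (simp add: n_def prime_imp_coprime)
  qed
  ultimately have "int n dvd int A"
    by (simp add: coprime_dvd_mult_left_iff)
  then show ?thesis unfolding A_def n_def by (simp only: int_dvd_int_iff)
qed

lemma prime_power_dvd_power_sum:
  fixes p a m :: nat
  assumes p: "prime p" and a: "1 \<le> a" "a \<le> m" and m: "\<not> (p - 1) dvd m"
  shows "p ^ a dvd S m (p ^ a)"
proof -
  have eq: "{1..p ^ a} = totatives (p ^ a) \<union> {j \<in> {1..p ^ a}. p dvd j}"
  proof -
    have "coprime j p" if "\<not> p dvd j" for j
      using prime_imp_coprime[OF p that] by (simp add: coprime_commute)
    then show ?thesis by (fastforce simp: in_totatives_iff)
  qed
  have "p ^ a dvd (\<Sum>j \<in> totatives (p ^ a). j ^ m)"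
    using p a m by (intro prime_power_dvd_sum_totatives)
  moreover have "p ^ a dvd (\<Sum>j | j \<in> {1..p ^ a} \<and> p dvd j. j ^ m)"
    using a by (auto intro!: dvd_sum dvd_imp_power_dvd_power_le)
  moreover have "totatives (p ^ a) \<inter> {j \<in> {1..p ^ a}. p dvd j} = {}"
    using p a by (auto simp: in_totatives_iff dest!: coprime_common_divisor)
  ultimately show ?thesis
    unfolding S_def by (subst eq, subst sum.union_disjoint) auto
qed

text \<open>
  Here \<open>m = p\<^bsup>k-1\<^esup> c\<close> with \<open>p - 1 = 2 c\<close>. It is not a multiple of \<open>2 c\<close> because \<open>p\<^bsup>k-1\<^esup>\<close> is odd.
\<close>

lemma prime_power_in_M_half_totient:
  fixes p k :: nat
  assumes p: "prime p" "odd p" and k: "k \<ge> 1"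
  shows "p ^ k \<in> M_half_totient"
proof -
  have p3: "p \<ge> 3" using p prime_ge_2_nat[of p] by (cases "p = 2") auto
  have n3: "p ^ k \<ge> 3"
    using p3 k self_le_power[of p k] by linarith
  obtain c where c: "p - 1 = 2 * c" using p by (auto elim!: evenE oddE)
  define m where "m = totient (p ^ k) div 2"
  have m: "m = p ^ (k - 1) * c"
    using p k c by (simp add: m_def totient_prime_power)
  have "c \<ge> 1" using c p3 by simp
  have "\<not> (p - 1) dvd m"
  proof
    assume "(p - 1) dvd m"
    then have "2 * c dvd p ^ (k - 1) * c"
      by (simp only: m c)
    then have "2 dvd p ^ (k - 1)"
      using \<open>c \<ge> 1\<close> by simp
    moreover have "odd (p ^ (k - 1))" using p by simp
    ultimately show False by blast
  qed
  moreover have "k \<le> m"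
  proof -
    have "k - 1 < 2 ^ (k - 1)" by (rule less_exp)
    also have "\<dots> \<le> p ^ (k - 1)" using p3 by (simp add: power_mono)
    also have "\<dots> \<le> m" using \<open>c \<ge> 1\<close> by (simp add: m)
    finally show ?thesis by simp
  qed
  ultimately show ?thesis
    using prime_power_dvd_power_sum[of p k m] p k n3 by (simp add: M_half_totient_def m_def)
qed

text \<open>
  From \<open>k = 4\<close> on, \<open>m = 2\<^bsup>k-2\<^esup>\<close> is the exponent of the unit group and at least \<open>k\<close>. For
  \<open>k = 2\<close> the exponent is \<open>2\<close> while \<open>m = 1\<close>, and for \<open>k = 3\<close> the bound \<open>k \<le> m\<close> fails, so the
  general criterion does not apply to these two.
\<close>

lemma two_power_notin_M_half_totient:
  "2 ^ k \<notin> M_half_totient"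
proof
  assume *: "2 ^ k \<in> M_half_totient"
  have "(2::nat) ^ k \<le> 2" if "k \<le> 1"
    using that by (cases k) auto
  with * consider "k = 2" | "k = 3" | "k \<ge> 4"
    by (force simp: M_half_totient_def)
  then show False
  proof cases
    case 1
    have "totient (2 ^ 2) = 2" by (subst totient_prime_power) auto
    moreover have "S 1 4 = 10" by (simp add: S_def numeral_eq_Suc)
    ultimately show ?thesis
      using 1 * by (simp add: M_half_totient_def)
  next
    case 2
    have "totient (2 ^ 3) = 4" by (subst totient_prime_power) auto
    moreover have "S 2 8 = 204" by (simp add: S_def numeral_eq_Suc)
    ultimately show ?thesis
      using 2 * by (simp add: M_half_totient_def)
  next
    case 3
    then have "k - 1 = Suc (k - 2)" by simp
    then have t: "totient (2 ^ k) div 2 = 2 ^ (k - 2)"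
      using 3 totient_prime_power[of 2 k] by simp
    have "j + 4 \<le> 2 ^ (j + 2)" for j :: nat
      by (induction j) auto
    moreover have "k - 4 + 4 = k" "k - 4 + 2 = k - 2" using 3 by simp_all
    ultimately have "k \<le> 2 ^ (k - 2)" by metis
    moreover have "Carmichael (2 ^ k) dvd 2 ^ (k - 2)"
      using 3 by (simp add: Carmichael_twopow)
    ultimately have "\<not> 2 ^ k dvd S (2 ^ (k - 2)) (2 ^ k)"
      using 3 by (intro power_sum_not_dvd[where r = 1]) auto
    with * t show ?thesis by (simp add: M_half_totient_def)
  qed
qed

text \<open>
  Since \<open>\<phi>(r)\<close> is even, \<open>\<phi>(p\<^sup>a r)/2\<close> is a positive multiple of \<open>\<phi>(p\<^sup>a)\<close>, hence of the exponent
  of the unit group modulo \<open>p\<^sup>a\<close>.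
\<close>

lemma coprime_product_notin_M_half_totient:
  fixes p a r :: nat
  assumes p: "prime p" and a: "a \<ge> 1" and r: "coprime p r" "r \<ge> 3"
  shows "p ^ a * r \<notin> M_half_totient"
proof
  define m where "m = totient (p ^ a * r) div 2"
  assume "p ^ a * r \<in> M_half_totient"
  then have "p ^ a * r dvd S m (p ^ a * r)"
    by (simp add: M_half_totient_def m_def)
  then have "p ^ a dvd S m (p ^ a * r)"
    using dvd_mult_left by blast
  moreover obtain c where c: "totient r = 2 * c"
    using totient_even[of r] r by (auto elim: evenE)
  then have m: "m = totient (p ^ a) * c"
    using r totient_mult_coprime[of "p ^ a" r] by (simp add: m_def)
  have "c \<ge> 1"
    using c r totient_gt_0_iff[of r] by (cases c) auto
  then have "a \<le> m"
    using le_totient_prime_power[OF p a] m by (metis le_trans mult.commute mult_le_mono1 mult_1)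
  moreover have "Carmichael (p ^ a) dvd m"
    using m Carmichael_dvd_totient by simp
  ultimately show False
    using power_sum_not_dvd p a r by blast
qed

theorem proposition11:
  "M_half_totient = {p ^ k | p k :: nat. prime p \<and> odd p \<and> k \<ge> 1}"
proof (intro equalityI subsetI)
  fix n assume *: "n \<in> M_half_totient"
  then have n: "n \<ge> 3" by (simp add: M_half_totient_def)
  \<comment> \<open>Taking \<open>p = 2\<close> for even \<open>n\<close> keeps the cofactor \<open>r\<close> odd, so that it is either \<open>1\<close> or at
      least \<open>3\<close>; a cofactor \<open>2\<close> would have \<open>\<phi>(2) = 1\<close>, which is odd.\<close>
  obtain p where p: "prime p" "p dvd n" "even n \<Longrightarrow> p = 2"
  proof (cases "even n")
    case True
    then show ?thesis using that[of 2] by simp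
  next
    case False
    then show ?thesis using that prime_factor_nat[of n] n by fastforce
  qed
  define a where "a = multiplicity p n"
  obtain r where r: "n = p ^ a * r" "\<not> p dvd r"
  proof (rule multiplicity_decompose'[of n p])
    show "n \<noteq> 0" "\<not> is_unit p" using n p not_prime_unit by auto
  qed (auto simp: a_def)
  have a: "a \<ge> 1"
  proof (rule ccontr)
    assume "\<not> a \<ge> 1"
    then have "a = 0" by simp
    then have "n = r" using r(1) by simp
    with p(2) r(2) show False by simp
  qed
  have "coprime p r" using p(1) r(2) by (rule prime_imp_coprime)
  moreover have "odd r" using p(3) r by (metis dvd_mult)
  moreover have "\<not> r \<ge> 3"
    using coprime_product_notin_M_half_totient[OF p(1) a] \<open>coprime p r\<close> * r(1) by blast
  ultimately have "r = 1" by presburger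
  with r have np: "n = p ^ a" by simp
  with * have "p \<noteq> 2" using two_power_notin_M_half_totient by blast
  with p(1) have "odd p" using prime_odd_nat[of p] prime_ge_2_nat[of p] by simp
  with np p(1) a show "n \<in> {p ^ k | p k :: nat. prime p \<and> odd p \<and> k \<ge> 1}" by blast
qed (use prime_power_in_M_half_totient in blast)

end
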